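(* Let $G$ be a reduced bipartite graph of rank $r\geqslant 6$ and order $n>c(r)=3\cdot 2^{r/2-2}+r/2$, with bipartition $\{X,Y\}$. Then $\min\{|X|,|Y|\}=r/2$.
   Context: All graphs are finite and simple. The rank of a graph $G$ is the rank (over the reals) of its adjacency matrix $A(G)$; for a bipartite graph this rank is always even. For a vertex $v$, $N(v)$ denotes the set of vertices adjacent to $v$. A graph is reduced if it has no isolated vertex and no two distinct vertices $u,v$ with $N(u)=N(v)$. A bipartition $\{X,Y\}$ of $G$ is a partition of $V(G)$ into two independent sets. *)

theory Defs
  imports "HOL-Analysis.Analysis"
begin

text \<open>A finite simple graph is given by its adjacency relation on a finite vertex type
  \<open>'v\<close>; the vertex set is \<open>UNIV\<close> and the order of the graph is \<open>CARD('v)\<close>.\<close>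

definition simple_graph :: "('v \<Rightarrow> 'v \<Rightarrow> bool) \<Rightarrow> bool" where
  "simple_graph E \<longleftrightarrow> symp E \<and> irreflp E"

definition adj_matrix :: "('v::finite \<Rightarrow> 'v \<Rightarrow> bool) \<Rightarrow> real ^ 'v ^ 'v" where
  "adj_matrix E = (\<chi> i j. if E i j then 1 else 0)"

definition graph_rank :: "('v::finite \<Rightarrow> 'v \<Rightarrow> bool) \<Rightarrow> nat" where
  "graph_rank E = rank (adj_matrix E)"

definition neighbors :: "('v \<Rightarrow> 'v \<Rightarrow> bool) \<Rightarrow> 'v \<Rightarrow> 'v set" where
  "neighbors E v = {u. E v u}"

definition reduced_graph :: "('v \<Rightarrow> 'v \<Rightarrow> bool) \<Rightarrow> bool" where
  "reduced_graph E \<longleftrightarrow> (\<forall>v. neighbors E v \<noteq> {})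
     \<and> (\<forall>u v. u \<noteq> v \<longrightarrow> neighbors E u \<noteq> neighbors E v)"

definition independent_set :: "('v \<Rightarrow> 'v \<Rightarrow> bool) \<Rightarrow> 'v set \<Rightarrow> bool" where
  "independent_set E S \<longleftrightarrow> (\<forall>u\<in>S. \<forall>v\<in>S. \<not> E u v)"

definition bipartition :: "('v \<Rightarrow> 'v \<Rightarrow> bool) \<Rightarrow> 'v set \<Rightarrow> 'v set \<Rightarrow> bool" where
  "bipartition E X Y \<longleftrightarrow> X \<union> Y = UNIV \<and> X \<inter> Y = {}
     \<and> independent_set E X \<and> independent_set E Y"

text \<open>Real-valued, so that \<open>r/2\<close> is exact division even before the rank is known to be even.\<close>

definition c_bound :: "nat \<Rightarrow> real" where
  "c_bound r = 3 * 2 powr (real r / 2 - 2) + real r / 2"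

end

theory Submission
  imports Defs
begin

text \<open>The biadjacency matrix of rank \<open>k = r/2\<close> is the table of products of two vector families
  \<open>A\<close>, \<open>B\<close> spanning the same \<open>k\<close>-dimensional space, all products being 0 or 1; both families
  are augmented by the zero vector. It must be shown that \<open>|A| + |B| \<le> 3\<cdot>2^(k-2) + k + 2\<close> whenever
  \<open>|A|, |B| \<ge> k + 2\<close>, which goes by induction on \<open>k\<close>. Let \<open>|A| \<ge> |B|\<close>. A nonzero \<open>b \<in> B\<close> cuts
  \<open>A\<close> into the sections \<open>A0\<close>, \<open>A1\<close> of product 0 and 1, and after a reflection \<open>|A0| \<ge> |A1|\<close>.

  If \<open>A0\<close> spans the hyperplane orthogonal to \<open>b\<close>, then \<open>A0\<close> and the projection of \<open>B\<close> along \<open>b\<close>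
  form a pair of dimension \<open>k - 1\<close>. A projected point has two preimages only if these are \<open>x\<close> and
  \<open>x + b\<close>, and the set \<open>D\<close> of such \<open>x\<close> is orthogonal to \<open>A1\<close>; so \<open>|D| \<le> 2^e\<close> and
  \<open>|A1| \<le> 2^(k-1-e)\<close>, where \<open>e\<close> is the dimension of \<open>D\<close>.

  If no large section spans a hyperplane and the bound fails, then \<open>|A| > 3\<cdot>2^(k-3)\<close> forces \<open>A0\<close> to
  have dimension \<open>k - 2\<close> and density above \<open>3/4\<close> there, whence \<open>B\<close> has at most \<open>k - 1\<close> projections
  onto the span of \<open>A0\<close>, with fibres of size at most 4, and \<open>B\<close> is too small.\<close>

section \<open>Orthogonal projection and counting by binary products\<close>

lemma inner_eq_on_spanning_imp_eq:
  fixes x y :: "'a::euclidean_space"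
  assumes "x \<in> span S" "y \<in> span S" "\<And>s. s \<in> S \<Longrightarrow> x \<bullet> s = y \<bullet> s"
  shows "x = y"
proof -
  have "orthogonal (x - y) z" if "z \<in> span S" for z
    using that by (rule orthogonal_to_span) (simp add: orthogonal_def inner_diff_left assms(3))
  moreover have "x - y \<in> span S" using assms by (simp add: span_diff)
  ultimately have "orthogonal (x - y) (x - y)" by blast
  then show ?thesis by (simp add: orthogonal_def)
qed

lemma orthogonal_projection_exists:
  fixes S :: "'a::euclidean_space set"
  obtains p :: "'a \<Rightarrow> 'a"
  where "linear p" "\<And>x. p x \<in> span S" "\<And>x w. w \<in> span S \<Longrightarrow> w \<bullet> p x = w \<bullet> x"
    "\<And>w. w \<in> span S \<Longrightarrow> p w = w"
proof -
  have "\<exists>y. y \<in> span S \<and> (\<forall>w\<in>span S. w \<bullet> y = w \<bullet> x)" for x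
  proof -
    obtain y z where "y \<in> span S" "\<And>w. w \<in> span S \<Longrightarrow> orthogonal z w" "x = y + z"
      using orthogonal_subspace_decomp_exists[of S x] by blast
    then show ?thesis
      by (intro exI[of _ y]) (auto simp: orthogonal_def inner_add_right inner_commute)
  qed
  then obtain p where p: "\<And>x. p x \<in> span S" "\<And>x w. w \<in> span S \<Longrightarrow> w \<bullet> p x = w \<bullet> x"
    by metis
  \<comment> \<open>The product condition determines the projection; linearity follows because sums
    and multiples satisfy it too.\<close>
  have uniq: "p x = y" if "y \<in> span S" "\<And>w. w \<in> span S \<Longrightarrow> w \<bullet> y = w \<bullet> x" for x y
    by (rule inner_eq_on_spanning_imp_eq[where S = S])
      (use that p in \<open>auto simp: inner_commute span_base\<close>)
  have "linear p"
    by (rule linearI; rule uniq)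
      (auto simp: p span_add span_scale inner_add_right)
  then show ?thesis using that p uniq by blast
qed

text \<open>A basis of \<open>C\<close> is extended inside \<open>B\<close> to a basis of
  \<open>B\<close>. A vector of \<open>A\<close> is determined by its products with this basis;
  those with \<open>C\<close> are common to all of \<open>A\<close>, which leaves
  \<open>dim B - dim C\<close> binary choices.\<close>

lemma card_le_pow_dim_diff:
  fixes A B C :: "'a::euclidean_space set"
  assumes "finite B" "A \<subseteq> span B" "C \<subseteq> B"
    and bin: "\<And>a b. a \<in> A \<Longrightarrow> b \<in> B \<Longrightarrow> a \<bullet> b = 0 \<or> a \<bullet> b = 1"
    and const: "\<And>a a' c. a \<in> A \<Longrightarrow> a' \<in> A \<Longrightarrow> c \<in> C \<Longrightarrow> a \<bullet> c = a' \<bullet> c"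
  shows "card A \<le> 2 ^ (dim B - dim C)"
proof -
  obtain C' where C': "C' \<subseteq> C" "independent C'" "C \<subseteq> span C'" "card C' = dim C"
    using basis_exists by blast
  obtain B' where B': "C' \<subseteq> B'" "B' \<subseteq> B" "independent B'" "B \<subseteq> span B'"
    using maximal_independent_subset_extend[of C' B] C' assms(3) by blast
  have cB: "card B' = dim B" using B' by (intro basis_card_eq_dim) auto
  have fB: "finite B'" using B'(2) assms(1) finite_subset by blast
  have AB: "A \<subseteq> span B'" using assms(2) B'(4) by (metis span_mono span_span subset_trans)
  let ?f = "\<lambda>a. {b \<in> B' - C'. a \<bullet> b = 1}"
  have "inj_on ?f A"
  proof (rule inj_onI)
    fix a a' assume aa: "a \<in> A" "a' \<in> A" "?f a = ?f a'"
    show "a = a'"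
    proof (rule inner_eq_on_spanning_imp_eq[where S = B'])
      show "a \<bullet> b = a' \<bullet> b" if "b \<in> B'" for b
      proof (cases "b \<in> C'")
        case True then show ?thesis using const aa C' by blast
      next
        case False
        then have "(a \<bullet> b = 1) = (a' \<bullet> b = 1)" using aa(3) that by blast
        then show ?thesis using bin aa B' that by (metis subsetD)
      qed
    qed (use AB aa in auto)
  qed
  then have "card A \<le> card (Pow (B' - C'))"
    by (intro card_inj_on_le[of ?f]) (use fB in auto)
  also have "\<dots> = 2 ^ (dim B - dim C)"
    using B' C' fB cB by (simp add: card_Pow card_Diff_subset finite_subset)
  finally show ?thesis .
qed

section \<open>Pairs of vector families with products 0 and 1\<close>

text \<open>Equal spans make each family separate the points of the other. Containing 0 keeps zero
  sections and projections eligible as members of a smaller pair.\<close>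

definition two_level :: "'a::euclidean_space set \<Rightarrow> 'a set \<Rightarrow> nat \<Rightarrow> bool" where
  "two_level A B d \<longleftrightarrow> finite A \<and> finite B \<and> 0 \<in> A \<and> 0 \<in> B \<and> span A = span B \<and> dim A = d
     \<and> (\<forall>a\<in>A. \<forall>b\<in>B. a \<bullet> b = 0 \<or> a \<bullet> b = 1)"

lemma two_level_sym: "two_level A B d \<Longrightarrow> two_level B A d"
  unfolding two_level_def by (metis inner_commute dim_span)

lemma two_level_dim2: "two_level A B d \<Longrightarrow> dim B = d"
  using two_level_sym two_level_def by blast

lemma two_level_card_le: "two_level A B d \<Longrightarrow> card A \<le> 2 ^ d"
  using card_le_pow_dim_diff[of B A "{}"] two_level_dim2[of A B d] span_superset[of A]
  unfolding two_level_def by auto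

lemma two_level_card_ge:
  assumes "two_level A B d"
  shows "d + 1 \<le> card A"
proof -
  have "dim (A - {0}) = dim A" by (metis dim_span span_delete_0)
  then have "d \<le> card (A - {0})"
    using assms dim_le_card'[of "A - {0}"] unfolding two_level_def by auto
  then show ?thesis using assms unfolding two_level_def
    by (metis card_Suc_Diff1 Suc_eq_plus1 Suc_le_mono)
qed

text \<open>Projecting onto the span of \<open>A0\<close> leaves the products with \<open>A0\<close>
  unchanged, and the image of \<open>B\<close> spans that space because \<open>p\<close> fixes it.
  Points of \<open>B\<close> may merge, so fibres of \<open>p\<close> have to be counted
  separately.\<close>

lemma two_level_project:
  assumes "two_level A B d" "A0 \<subseteq> A" "0 \<in> A0"
    and p: "linear p" "\<And>x. p x \<in> span A0" "\<And>x w. w \<in> span A0 \<Longrightarrow> w \<bullet> p x = w \<bullet> x"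
      "\<And>w. w \<in> span A0 \<Longrightarrow> p w = w"
  shows "two_level A0 (p ` B) (dim A0)"
proof -
  have "span (p ` B) = p ` span A"
    using assms(1) p(1) by (simp add: linear_span_image two_level_def)
  moreover have "span A0 \<subseteq> p ` span A"
    using p(4) span_mono[OF assms(2)] by (metis image_eqI subset_eq)
  moreover have "p ` span A \<subseteq> span A0" using p(2) by blast
  ultimately have "span A0 = span (p ` B)" by blast
  moreover have "0 \<in> p ` B" using assms(1) linear_0[OF p(1)] unfolding two_level_def by force
  moreover have "a \<bullet> p b = 0 \<or> a \<bullet> p b = 1" if "a \<in> A0" "b \<in> B" for a b
    using that p(3)[OF span_base, of a b] assms(1,2) unfolding two_level_def by auto
  ultimately show ?thesis
    using assms(1-3) finite_subset unfolding two_level_def by blast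
qed

lemma two_level_card_subset_le:
  assumes "two_level A B d" "A0 \<subseteq> A" "0 \<in> A0"
  shows "card A0 \<le> 2 ^ dim A0"
proof -
  obtain p where "linear p" "\<And>x. p x \<in> span A0" "\<And>x w. w \<in> span A0 \<Longrightarrow> w \<bullet> p x = w \<bullet> x"
    "\<And>w. w \<in> span A0 \<Longrightarrow> p w = w"
    using orthogonal_projection_exists[of A0] by blast
  then show ?thesis using two_level_project[OF assms] two_level_card_le by blast
qed

lemma card_le_fibres:
  assumes "finite A" "\<And>y. y \<in> f ` A \<Longrightarrow> card {x \<in> A. f x = y} \<le> m"
  shows "card A \<le> m * card (f ` A)"
proof -
  have "card A = (\<Sum>y\<in>f ` A. card {x \<in> A. f x = y})"
    using sum.image_gen[OF assms(1), of "\<lambda>_. 1::nat" f] by simp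
  also have "\<dots> \<le> (\<Sum>y\<in>f ` A. m)" using assms(2) by (intro sum_mono)
  finally show ?thesis by (simp add: mult.commute)
qed

text \<open>A vector of \<open>B\<close> outside a basis \<open>B' \<subseteq> B\<close> has two nonzero coordinates \<open>u i\<close>, \<open>u j\<close>.
  Among the four ways of choosing the products with \<open>i\<close> and \<open>j\<close>, the others being fixed, one
  violates the condition that its product is 0 or 1.\<close>

lemma two_level_card_le_three_quarters:
  assumes tl: "two_level A B d" and "card B \<ge> d + 2"
  shows "4 * card A \<le> 3 * 2 ^ d"
proof -
  note tl' = tl[unfolded two_level_def]
  obtain B' where B': "B' \<subseteq> B" "independent B'" "B \<subseteq> span B'" "card B' = dim B"
    using basis_exists by blast
  have fB: "finite B'" using B' tl' finite_subset by blast
  have cB: "card B' = d" using B' two_level_dim2[OF tl] by simp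
  have "card (insert 0 B') \<le> d + 1" using cB fB by (simp add: card_insert_if)
  then have "\<not> B \<subseteq> insert 0 B'"
    using assms(2) fB card_mono[of "insert 0 B'" B] by fastforce
  then obtain c where c: "c \<in> B" "c \<noteq> 0" "c \<notin> B'" by blast
  then have "c \<in> span B'" using B' by blast
  then obtain u where u: "c = (\<Sum>v\<in>B'. u v *\<^sub>R v)"
    using span_finite[OF fB] by auto
  have bin: "\<And>a b. a \<in> A \<Longrightarrow> b \<in> B \<Longrightarrow> a \<bullet> b = 0 \<or> a \<bullet> b = 1" using tl' by blast
  have "\<exists>i\<in>B'. u i \<noteq> 0" using u c(2) by (metis (no_types, lifting) scale_eq_0_iff sum.neutral)
  then obtain i where i: "i \<in> B'" "u i \<noteq> 0" by blast
  \<comment> \<open>With one nonzero coordinate, \<open>c\<close> would be a multiple of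
    \<open>i\<close>; a vector having product 1 with \<open>i\<close> forces the factor 1, so
    \<open>c\<close> would be the basis vector \<open>i\<close> itself.\<close>
  have "\<exists>j\<in>B' - {i}. u j \<noteq> 0"
  proof (rule ccontr)
    assume "\<not> ?thesis"
    then have "c = u i *\<^sub>R i"
      unfolding u using fB i(1) by (simp add: sum.remove)
    have "i \<noteq> 0" using B'(2) i(1) dependent_zero by blast
    moreover have "i \<in> span A" using tl' B' i(1) by (metis span_base subsetD)
    ultimately have "\<exists>a\<in>A. a \<bullet> i \<noteq> 0"
      using inner_eq_on_spanning_imp_eq[of i A 0] by (auto simp: inner_commute span_zero)
    then obtain a where a: "a \<in> A" "a \<bullet> i \<noteq> 0" by blast
    then have "a \<bullet> i = 1" using bin B' i(1) by blast
    then have "a \<bullet> c = u i" using \<open>c = u i *\<^sub>R i\<close> by simp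
    then have "u i = 1" using bin[OF a(1) c(1)] i(2) by auto
    then show False using \<open>c = u i *\<^sub>R i\<close> c(3) i(1) by simp
  qed
  then obtain j where j: "j \<in> B'" "j \<noteq> i" "u j \<noteq> 0" by blast
  let ?R = "B' - {i, j}"
  let ?f = "\<lambda>a. {b \<in> ?R. a \<bullet> b = 1}"
  have dec: "a \<bullet> c = u i * (a \<bullet> i) + u j * (a \<bullet> j) + (\<Sum>v\<in>?R. u v * (a \<bullet> v))" for a
  proof -
    have "a \<bullet> c = (\<Sum>v\<in>B'. u v * (a \<bullet> v))" unfolding u by (simp add: inner_sum_right)
    also have "\<dots> = u i * (a \<bullet> i) + (\<Sum>v\<in>B' - {i}. u v * (a \<bullet> v))"
      using fB i by (simp add: sum.remove)
    also have "(\<Sum>v\<in>B' - {i}. u v * (a \<bullet> v)) = u j * (a \<bullet> j) + (\<Sum>v\<in>B' - {i} - {j}. u v * (a \<bullet> v))"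
      using fB j by (intro sum.remove) auto
    also have "B' - {i} - {j} = ?R" by blast
    finally show ?thesis by simp
  qed
  have "card {a \<in> A. ?f a = y} \<le> 3" for y
  proof -
    let ?F = "{a \<in> A. ?f a = y}"
    let ?g = "\<lambda>a. (a \<bullet> i, a \<bullet> j)"
    have same: "a \<bullet> b = a' \<bullet> b" if "a \<in> ?F" "a' \<in> ?F" "b \<in> ?R" for a a' b
    proof -
      have "(a \<bullet> b = 1) = (a' \<bullet> b = 1)" using that by blast
      moreover have "b \<in> B" using that B' by blast
      moreover have "a \<in> A" "a' \<in> A" using that by blast+
      ultimately show ?thesis using bin by metis
    qed
    have "inj_on ?g ?F"
    proof (rule inj_onI)
      fix a a' assume aa: "a \<in> ?F" "a' \<in> ?F" "?g a = ?g a'"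
      show "a = a'"
      proof (rule inner_eq_on_spanning_imp_eq[where S = B'])
        have "span A \<subseteq> span B'" using tl' B'(3) by (metis span_mono span_span)
        then show "a \<in> span B'" "a' \<in> span B'" using aa by (auto simp: span_base subset_eq)
        show "a \<bullet> b = a' \<bullet> b" if "b \<in> B'" for b
          using same[OF aa(1,2), of b] that aa(3) by (cases "b = i"; cases "b = j") auto
      qed
    qed
    then have "card ?F = card (?g ` ?F)" by (simp add: card_image)
    also have "\<dots> \<le> 3"
    proof -
      let ?Q = "{0::real, 1} \<times> {0::real, 1}"
      have sub: "?g ` ?F \<subseteq> ?Q" 
      proof (rule image_subsetI)
        fix a assume "a \<in> ?F"
        then have "a \<in> A" by simp
        moreover have "i \<in> B" "j \<in> B" using B' i j by auto
        ultimately show "?g a \<in> ?Q" using bin by auto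
      qed
      have "?g ` ?F \<noteq> ?Q"
      proof
        assume eq: "?g ` ?F = ?Q"
        have ex: "\<exists>a\<in>?F. a \<bullet> i = x \<and> a \<bullet> j = y" if "(x, y) \<in> ?Q" for x y
          using that unfolding eq[symmetric] by blast
        have Q: "(0, 0) \<in> ?Q" "(0, 1) \<in> ?Q" "(1, 0) \<in> ?Q" "(1, 1) \<in> ?Q" by simp_all
        obtain a00 where a00: "a00 \<in> ?F" "a00 \<bullet> i = 0 \<and> a00 \<bullet> j = 0"
          using ex[OF Q(1)] by (rule bexE)
        obtain a01 where a01: "a01 \<in> ?F" "a01 \<bullet> i = 0 \<and> a01 \<bullet> j = 1"
          using ex[OF Q(2)] by (rule bexE)
        obtain a10 where a10: "a10 \<in> ?F" "a10 \<bullet> i = 1 \<and> a10 \<bullet> j = 0"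
          using ex[OF Q(3)] by (rule bexE)
        obtain a11 where a11: "a11 \<in> ?F" "a11 \<bullet> i = 1 \<and> a11 \<bullet> j = 1"
          using ex[OF Q(4)] by (rule bexE)
        define t where "t = (\<Sum>v\<in>?R. u v * (a00 \<bullet> v))"
        have t: "(\<Sum>v\<in>?R. u v * (a \<bullet> v)) = t" if "a \<in> ?F" for a
          unfolding t_def using same[OF that a00(1)] by (intro sum.cong) auto
        have "a00 \<bullet> c = t" "a01 \<bullet> c = u j + t" "a10 \<bullet> c = u i + t" "a11 \<bullet> c = u i + u j + t"
          using dec[of a00] dec[of a01] dec[of a10] dec[of a11]
            t[OF a00(1)] t[OF a01(1)] t[OF a10(1)] t[OF a11(1)]
            a00(2) a01(2) a10(2) a11(2) by simp_all
        moreover have "a00 \<in> A" "a01 \<in> A" "a10 \<in> A" "a11 \<in> A"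
          using a00(1) a01(1) a10(1) a11(1) by blast+
        ultimately have "t = 0 \<or> t = 1" "u j + t = 0 \<or> u j + t = 1"
          "u i + t = 0 \<or> u i + t = 1" "u i + u j + t = 0 \<or> u i + u j + t = 1"
          using bin[OF _ c(1)] by metis+
        \<comment> \<open>\<open>t = 0\<close> forces \<open>u i = u j = 1\<close> and the last
          value 2; \<open>t = 1\<close> forces \<open>u i = u j = -1\<close> and the last value
          -1.\<close>
        then show False using i(2) j(3) by linarith
      qed
      then have "card (?g ` ?F) < card ?Q" using sub by (intro psubset_card_mono) auto
      then show ?thesis by (simp add: card_cartesian_product)
    qed
    finally show ?thesis .
  qed
  then have "card A \<le> 3 * card (?f ` A)"
    using tl' by (intro card_le_fibres) auto
  moreover have "card (?f ` A) \<le> card (Pow ?R)"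
    using fB by (intro card_mono) auto
  moreover have "card (Pow ?R) = 2 ^ (d - 2)"
    using fB i(1) j(1,2) cB by (simp add: card_Pow card_Diff_subset)
  moreover have "d \<ge> 2"
    using card_mono[OF fB, of "{i, j}"] i(1) j(1,2) cB by auto
  then have "(2::nat) ^ d = 4 * 2 ^ (d - 2)"
    by (metis le_add_diff_inverse power_add power2_eq_square mult_2_right numeral_Bit0)
  ultimately show ?thesis by linarith
qed

section \<open>Sections of a family and the reflection\<close>

lemma two_level_card_split:
  assumes tl: "two_level A B d" and b: "b \<in> B"
  shows "card A = card {a \<in> A. a \<bullet> b = 0} + card {a \<in> A. a \<bullet> b = 1}"
proof -
  have "A = {a \<in> A. a \<bullet> b = 0} \<union> {a \<in> A. a \<bullet> b = 1}"
    using tl b unfolding two_level_def by blast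
  moreover have "card ({a \<in> A. a \<bullet> b = 0} \<union> {a \<in> A. a \<bullet> b = 1})
      = card {a \<in> A. a \<bullet> b = 0} + card {a \<in> A. a \<bullet> b = 1}"
    using tl unfolding two_level_def by (intro card_Un_disjoint) auto
  ultimately show ?thesis by simp
qed

text \<open>If the section of product 1 is the larger one, take \<open>c\<close> in it, replace each
  \<open>a\<close> by \<open>c - a\<close> and negate every \<open>y\<close> orthogonal to
  \<open>c\<close>. Each product is then kept or replaced by its difference from 1, and the two
  sections of \<open>b\<close> change places.\<close>

lemma two_level_flip:
  fixes A B :: "'a::euclidean_space set"
  assumes tl: "two_level A B d" and b: "b \<in> B" "b \<noteq> 0"
  obtains A' B' :: "'a set" and b' where "two_level A' B' d" "card A' = card A" "card B' = card B"
    "b' \<in> B'" "b' \<noteq> 0" "card A' \<le> 2 * card {a \<in> A'. a \<bullet> b' = 0}"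
proof (cases "card A \<le> 2 * card {a \<in> A. a \<bullet> b = 0}")
  case True
  show ?thesis by (rule that[OF tl refl refl b True])
next
  case False
  note tl' = tl[unfolded two_level_def]
  have bin: "\<And>a b. a \<in> A \<Longrightarrow> b \<in> B \<Longrightarrow> a \<bullet> b = 0 \<or> a \<bullet> b = 1" using tl' by blast
  have "card A = card {a \<in> A. a \<bullet> b = 0} + card {a \<in> A. a \<bullet> b = 1}"
    by (rule two_level_card_split[OF tl b(1)])
  with False have big: "card A \<le> 2 * card {a \<in> A. a \<bullet> b = 1}"
    and "card {a \<in> A. a \<bullet> b = 1} \<noteq> 0" by linarith+
  then obtain c where c: "c \<in> A" "c \<bullet> b = 1" by (metis (mono_tags, lifting) card.empty empty_Collect_eq)
  let ?s = "\<lambda>y. if c \<bullet> y = 1 then y else - y"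
  let ?A = "(\<lambda>a. c - a) ` A" and ?B = "?s ` B"
  \<comment> \<open>The product with \<open>c\<close> survives the change of sign, so it tells which
    branch was taken.\<close>
  have "inj_on ?s B"
  proof (rule inj_onI)
    fix x y assume "x \<in> B" "y \<in> B" "?s x = ?s y"
    then show "x = y" using bin[OF c(1), of x] bin[OF c(1), of y]
      by (auto split: if_splits)
  qed
  then have cB: "card ?B = card B" by (rule card_image)
  have injA: "inj_on (\<lambda>a. c - a) S" for S by (simp add: inj_on_def)
  then have cA: "card ?A = card A" by (rule card_image)
  have sA: "span ?A = span A"
  proof (rule span_eq[THEN iffD2], intro conjI subsetI)
    fix x assume "x \<in> ?A" then show "x \<in> span A" using c by (auto intro: span_diff span_base)
  next
    fix x assume x: "x \<in> A"
    have "c - 0 \<in> ?A" using tl' by blast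
    moreover have "c - x \<in> ?A" using x by blast
    ultimately have "(c - 0) - (c - x) \<in> span ?A" by (intro span_diff span_base)
    then show "x \<in> span ?A" by simp
  qed
  have sB: "span ?B = span B"
  proof (rule span_eq[THEN iffD2], intro conjI subsetI)
    fix x assume "x \<in> ?B" then show "x \<in> span B" by (auto intro: span_neg span_base)
  next
    fix x assume x: "x \<in> B"
    then have "?s x \<in> span ?B" by (intro span_base) blast
    then show "x \<in> span ?B" by (auto split: if_splits dest: span_neg)
  qed
  have "(c - a) \<bullet> ?s y = 0 \<or> (c - a) \<bullet> ?s y = 1" if "a \<in> A" "y \<in> B" for a y
    using bin[OF that] bin[OF c(1) that(2)] by (auto simp: inner_diff_left)
  moreover have "0 \<in> ?A" using c(1) by force
  moreover have "0 \<in> ?B" using tl' by force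
  moreover have "dim ?A = d" using sA tl' by (metis dim_span)
  ultimately have "two_level ?A ?B d"
    using tl' sA sB unfolding two_level_def by (simp only: finite_imageI ball_simps) blast
  moreover have "b \<in> ?B" using b c(2) by force
  moreover have "{a \<in> ?A. a \<bullet> b = 0} = (\<lambda>a. c - a) ` {a \<in> A. a \<bullet> b = 1}"
    using c(2) by (auto simp: inner_diff_left)
  then have "card {a \<in> ?A. a \<bullet> b = 0} = card {a \<in> A. a \<bullet> b = 1}"
    using card_image[OF injA] by simp
  ultimately show ?thesis using that[of ?A ?B b] cA cB b(2) big by simp
qed

section \<open>The inductive step for a section spanning a hyperplane\<close>

text \<open>With \<open>e = x + 1\<close> and \<open>d - 1 - e = y + 1\<close> this is twice the
  rearranged inequality \<open>(2^x - 1) (2^y - 1) \<ge> 0\<close>.\<close>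

lemma two_power_add_le:
  fixes d e :: nat
  assumes "1 \<le> e" "e + 2 \<le> d"
  shows "(2::nat) ^ (d - 1 - e) + 2 ^ e \<le> 2 ^ (d - 2) + 2"
proof -
  obtain x where x: "e = Suc x" using assms(1) by (cases e) auto
  define y where "y = d - 2 - e"
  have d: "d - 1 - e = Suc y" "d - 2 = Suc (x + y)" using assms(2) x y_def by auto
  have "(2::nat) ^ x \<ge> 1" "(2::nat) ^ y \<ge> 1" by simp_all
  then have "0 \<le> ((2::int) ^ x - 1) * (2 ^ y - 1)" by simp
  then have "(2::int) ^ x + 2 ^ y \<le> 2 ^ (x + y) + 1" by (simp add: algebra_simps power_add)
  then have "(2::nat) ^ x + 2 ^ y \<le> 2 ^ (x + y) + 1"
    by (metis (mono_tags, lifting) of_nat_1 of_nat_add of_nat_le_iff of_nat_numeral of_nat_power)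
  moreover have "(2::nat) ^ (d - 1 - e) = 2 * 2 ^ y" "(2::nat) ^ e = 2 * 2 ^ x"
    "(2::nat) ^ (d - 2) = 2 * 2 ^ (x + y)" using d x by (simp_all only: power_Suc)
  ultimately show ?thesis by linarith
qed

lemma linear_le_two_power:
  fixes d :: nat
  assumes "3 \<le> d"
  shows "d \<le> 2 * 2 ^ (d - 3) + 1"
  using assms
proof (induction d rule: dec_induct)
  case (step d)
  then have "Suc d - 3 = Suc (d - 3)" by simp
  with step show ?case by simp
qed simp

text \<open>The induction hypothesis applies only if \<open>A0\<close> and the projection of
  \<open>B\<close> both have at least \<open>d + 1\<close> points. Otherwise one of them has exactly
  \<open>d\<close>, and cruder bounds on the other suffice.\<close>

lemma two_level_full_section:
  fixes A B :: "'a::euclidean_space set"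
  assumes tl: "two_level A B d" and "d \<ge> 3"
    and cA: "card A \<ge> d + 2" and cB: "card B \<ge> d + 2"
    and b: "b \<in> B" "b \<noteq> 0"
    and big: "card A \<le> 2 * card {a \<in> A. a \<bullet> b = 0}"
    and full: "dim {a \<in> A. a \<bullet> b = 0} = d - 1"
    and IH: "\<And>A B :: 'a set. two_level A B (d - 1) \<Longrightarrow> card A \<ge> d + 1 \<Longrightarrow> card B \<ge> d + 1
      \<Longrightarrow> 4 * (card A + card B) \<le> 3 * 2 ^ (d - 1) + 4 * (d - 1) + 8"
  shows "4 * (card A + card B) \<le> 3 * 2 ^ d + 4 * d + 8"
proof -
  note tl' = tl[unfolded two_level_def]
  have bin: "\<And>a b. a \<in> A \<Longrightarrow> b \<in> B \<Longrightarrow> a \<bullet> b = 0 \<or> a \<bullet> b = 1" using tl' by blast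
  define A0 A1 where "A0 = {a \<in> A. a \<bullet> b = 0}" and "A1 = {a \<in> A. a \<bullet> b = 1}"
  have split: "card A = card A0 + card A1"
    unfolding A0_def A1_def by (rule two_level_card_split[OF tl b(1)])
  have A0: "A0 \<subseteq> A" "0 \<in> A0" using tl' by (auto simp: A0_def)
  have bspan: "b \<in> span A" using b tl' by (metis span_base)
  have "\<exists>a\<in>A. a \<bullet> b \<noteq> 0"
    using inner_eq_on_spanning_imp_eq[of b A 0] b(2) bspan by (auto simp: inner_commute span_zero)
  then obtain a1 where a1: "a1 \<in> A1" using bin b by (auto simp: A1_def)
  then have a1A: "a1 \<in> A" "a1 \<bullet> b = 1" by (auto simp: A1_def)
  obtain p where p: "linear p" "\<And>x. p x \<in> span A0" "\<And>x w. w \<in> span A0 \<Longrightarrow> w \<bullet> p x = w \<bullet> x"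
    "\<And>w. w \<in> span A0 \<Longrightarrow> p w = w"
    using orthogonal_projection_exists[of A0] by blast
  have tl0: "two_level A0 (p ` B) (d - 1)"
    using two_level_project[OF tl A0 p] full by (simp add: A0_def)
  have perp: "b \<bullet> w = 0" if "w \<in> span A0" for w
    using orthogonal_to_span[OF that, of b] by (simp add: orthogonal_def A0_def inner_commute)
  have "span (insert b A0) = span (span A)"
  proof (rule dim_eq_span)
    show "insert b A0 \<subseteq> span A" using bspan A0 by (auto simp: span_base)
    have "b \<notin> span A0" using perp[of b] b(2) by auto
    then show "dim (span A) \<le> dim (insert b A0)"
      using full tl' assms(2) two_level_dim2[OF tl] by (simp add: dim_insert A0_def)
  qed
  then have span: "span (insert b A0) = span A" by (simp only: span_span)
  \<comment> \<open>Equal projections give equal products with \<open>A0\<close>, which together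
    with \<open>b\<close> spans everything; so the difference is a multiple of
    \<open>b\<close>.\<close>
  have fibre: "\<exists>t. x = y + t *\<^sub>R b" if "x \<in> B" "y \<in> B" "p x = p y" for x y
  proof
    have xy: "x \<in> span A" "y \<in> span A" using that tl' by (metis span_base)+
    show "x = y + ((x - y) \<bullet> b / (b \<bullet> b)) *\<^sub>R b"
    proof (rule inner_eq_on_spanning_imp_eq[where S = "insert b A0"])
      show "x \<in> span (insert b A0)" "y + ((x - y) \<bullet> b / (b \<bullet> b)) *\<^sub>R b \<in> span (insert b A0)"
        unfolding span using xy bspan by (auto intro: span_add span_scale)
      show "x \<bullet> s = (y + ((x - y) \<bullet> b / (b \<bullet> b)) *\<^sub>R b) \<bullet> s" if "s \<in> insert b A0" for s
      proof (cases "s = b")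
        case True
        then show ?thesis using b(2) by (simp add: inner_diff_left inner_add_left)
      next
        case False
        then have s: "s \<in> span A0" using that by (simp add: span_base)
        then have "s \<bullet> x = s \<bullet> y" using p(3) \<open>p x = p y\<close> by metis
        moreover have "s \<bullet> b = 0" using perp[OF s] by (simp add: inner_commute)
        ultimately show ?thesis by (simp add: inner_add_right inner_commute[of _ s])
      qed
    qed
  qed
  have fibre': "x = y \<or> x = y + b \<or> y = x + b" if "x \<in> B" "y \<in> B" "p x = p y" for x y
  proof -
    obtain t where t: "x = y + t *\<^sub>R b" using fibre \<open>x \<in> B\<close> \<open>y \<in> B\<close> \<open>p x = p y\<close> by blast
    then have "a1 \<bullet> x = a1 \<bullet> y + t" using a1A by (simp add: inner_add_right)
    then have "t = 0 \<or> t = 1 \<or> t = -1"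
      using bin[OF a1A(1) that(1)] bin[OF a1A(1) that(2)] by auto
    then show ?thesis using t by auto
  qed
  \<comment> \<open>\<open>D\<close> holds the lower point of every fibre with two points. Deleting
    the upper points \<open>x + b\<close> makes \<open>p\<close> injective on the rest.\<close>
  define D where "D = {x \<in> B. x + b \<in> B}"
  have D: "D \<subseteq> B" "0 \<in> D" using tl' b by (auto simp: D_def)
  have fin: "finite A" "finite B" "finite D" using tl' D(1) finite_subset by auto
  have A1D: "a \<bullet> x = 0" if "a \<in> A1" "x \<in> D" for a x
  proof -
    have "a \<bullet> (x + b) = a \<bullet> x + 1" using that by (simp add: A1_def inner_add_right)
    then show ?thesis
      using bin[of a x] bin[of a "x + b"] that by (auto simp: A1_def D_def)
  qed
  have "inj_on p (B - (\<lambda>x. x + b) ` D)"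
    by (rule inj_onI) (use fibre' in \<open>auto simp: D_def\<close>)
  then have "card (B - (\<lambda>x. x + b) ` D) \<le> card (p ` B)"
    by (intro card_inj_on_le[of p]) (use fin in auto)
  moreover have "card ((\<lambda>x. x + b) ` D) = card D" by (intro card_image) (simp add: inj_on_def)
  moreover have "(\<lambda>x. x + b) ` D \<subseteq> B" by (auto simp: D_def)
  then have "card B = card (B - (\<lambda>x. x + b) ` D) + card ((\<lambda>x. x + b) ` D)"
    using fin by (metis card_Diff_subset card_mono finite_imageI le_add_diff_inverse2)
  ultimately have B_le: "card B \<le> card (p ` B) + card D" by linarith
  have "inj_on p D"
  proof (rule inj_onI)
    fix x y assume xy: "x \<in> D" "y \<in> D" "p x = p y"
    then have "x = y \<or> x = y + b \<or> y = x + b" using fibre' D by blast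
    moreover have "a1 \<bullet> x = a1 \<bullet> y" using A1D[OF a1] xy by simp
    ultimately show "x = y" using a1A by (auto simp: inner_add_right)
  qed
  then have D_le: "card D \<le> card (p ` B)"
    by (intro card_inj_on_le[of p]) (use fin D in auto)
  define e where "e = dim D"
  have De: "card D \<le> 2 ^ e"
    unfolding e_def by (rule two_level_card_subset_le[OF two_level_sym[OF tl] D])
  have "b \<notin> span D"
  proof
    assume "b \<in> span D"
    then have "orthogonal a1 b"
      by (rule orthogonal_to_span) (use A1D[OF a1] in \<open>simp add: orthogonal_def\<close>)
    then show False using a1A by (simp add: orthogonal_def)
  qed
  then have e1: "dim (insert b D) = e + 1" by (simp add: dim_insert e_def)
  have "dim (insert b D) \<le> dim B" using D b by (intro dim_subset) auto
  then have ed: "e + 1 \<le> d" using e1 two_level_dim2[OF tl] by simp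
  \<comment> \<open>Products of \<open>A1\<close> with \<open>D\<close> are 0 and with
    \<open>b\<close> are 1, so \<open>e + 1\<close> of the \<open>d\<close> dimensions are
    fixed.\<close>
  have "card A1 \<le> 2 ^ (dim B - dim (insert b D))"
  proof (rule card_le_pow_dim_diff)
    show "A1 \<subseteq> span B" using tl' span_superset[of A] by (auto simp: A1_def)
    show "insert b D \<subseteq> B" using D b by auto
    show "a \<bullet> c = a' \<bullet> c" if "a \<in> A1" "a' \<in> A1" "c \<in> insert b D" for a a' c
    proof (cases "c = b")
      case True
      then show ?thesis using that(1,2) by (simp add: A1_def)
    next
      case False
      then have "c \<in> D" using that(3) by simp
      then show ?thesis using A1D that(1,2) by metis
    qed
  qed (use fin bin in \<open>auto simp: A1_def\<close>)
  then have A1e: "card A1 \<le> 2 ^ (d - 1 - e)" using e1 two_level_dim2[OF tl] by simp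
  \<comment> \<open>In terms of \<open>N\<close> all bounds become linear, and the claim reads
    \<open>card A + card B \<le> 6 * N + d + 2\<close>.\<close>
  define N :: nat where "N = 2 ^ (d - 3)"
  have N: "2 ^ (d - 1) = 4 * N" "2 ^ d = 8 * N" "2 ^ (d - 2) = 2 * N" "N \<ge> 1"
  proof -
    obtain m where "d = m + 3" using assms(2) by (metis add.commute le_Suc_ex)
    then show "2 ^ (d - 1) = 4 * N" "2 ^ d = 8 * N" "2 ^ (d - 2) = 2 * N" "N \<ge> 1"
      by (simp_all add: N_def power_add numeral_eq_Suc)
  qed
  have dN: "d \<le> 2 * N + 1" using linear_le_two_power[OF assms(2)] by (simp add: N_def)
  have tl0': "two_level (p ` B) A0 (d - 1)" by (rule two_level_sym[OF tl0])
  have a0: "card A0 \<le> 4 * N" "card A0 \<ge> d"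
    using two_level_card_le[OF tl0] two_level_card_ge[OF tl0] N assms(2) by auto
  have pB: "card (p ` B) \<le> 4 * N" "card (p ` B) \<ge> d"
    using two_level_card_le[OF tl0'] two_level_card_ge[OF tl0'] N assms(2) by auto
  have a0': "card A0 \<le> 3 * N" if "card (p ` B) \<ge> d + 1"
    using two_level_card_le_three_quarters[OF tl0] that N assms(2) by auto
  have pB': "card (p ` B) \<le> 3 * N" if "card A0 \<ge> d + 1"
    using two_level_card_le_three_quarters[OF tl0'] that N assms(2) by auto
  have both: "card A0 + card (p ` B) \<le> 3 * N + d + 1"
    if "card A0 \<ge> d + 1" "card (p ` B) \<ge> d + 1"
    using IH[OF tl0 that] N assms(2) by auto
  have A10: "card A1 \<le> card A0" using big split by (simp add: A0_def)
  have "card A0 + card A1 + card (p ` B) + card D \<le> 6 * N + d + 2"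
  proof -
    consider "e = 0" | "e = d - 1" | "1 \<le> e" "e + 2 \<le> d" using ed by linarith
    then show ?thesis
    proof cases
      \<comment> \<open>\<open>D\<close> adds one point at most, so
        \<open>card B \<ge> d + 2\<close> leaves at least \<open>d + 1\<close> projected points, and
        \<open>A1\<close> is bounded by \<open>A0\<close>. In the next case \<open>A1\<close> and
        \<open>D\<close> exchange these roles.\<close>
      case 1
      then have "card D \<le> 1" using De by simp
      then show ?thesis using B_le cB a0 a0' pB both A10 dN
        by (cases "card A0 \<ge> d + 1") linarith+
    next
      case 2
      then have "card A1 \<le> 1" using A1e by simp
      then show ?thesis using split cA a0 pB pB' both D_le dN
        by (cases "card (p ` B) \<ge> d + 1") linarith+
    next
      case 3
      then have "card A1 + card D \<le> 2 * N + 2"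
        using two_power_add_le[of e d] A1e De N by linarith
      then show ?thesis using a0 pB both N(4)
        by (cases "card A0 \<ge> d + 1"; cases "card (p ` B) \<ge> d + 1") linarith+
    qed
  qed
  then show ?thesis using split B_le N by simp
qed

section \<open>Thin sections and the induction on the dimension\<close>

text \<open>\<open>thin\<close> is assumed for every large section, not only that of
  \<open>b\<close>, because the bound on the fibre over 0 applies it to other vectors of
  \<open>B\<close>.\<close>

lemma two_level_thin_section:
  fixes A B :: "'a::euclidean_space set"
  assumes tl: "two_level A B d" and "d \<ge> 3"
    and dense: "3 * 2 ^ d < 8 * card A"
    and b: "b \<in> B" "b \<noteq> 0"
    and big: "card A \<le> 2 * card {a \<in> A. a \<bullet> b = 0}"
    and thin: "\<And>b. b \<in> B \<Longrightarrow> b \<noteq> 0 \<Longrightarrow> card A \<le> 2 * card {a \<in> A. a \<bullet> b = 0}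
      \<Longrightarrow> dim {a \<in> A. a \<bullet> b = 0} \<le> d - 2"
  shows "4 * (card A + card B) \<le> 3 * 2 ^ d + 4 * d + 8"
proof -
  note tl' = tl[unfolded two_level_def]
  have bin: "\<And>a b. a \<in> A \<Longrightarrow> b \<in> B \<Longrightarrow> a \<bullet> b = 0 \<or> a \<bullet> b = 1" using tl' by blast
  have fin: "finite A" "finite B" using tl' by auto
  define A0 where "A0 = {a \<in> A. a \<bullet> b = 0}"
  have A0: "A0 \<subseteq> A" "0 \<in> A0" using tl' by (auto simp: A0_def)
  obtain p where p: "linear p" "\<And>x. p x \<in> span A0" "\<And>x w. w \<in> span A0 \<Longrightarrow> w \<bullet> p x = w \<bullet> x"
    "\<And>w. w \<in> span A0 \<Longrightarrow> p w = w"
    using orthogonal_projection_exists[of A0] by blast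
  have tl0: "two_level A0 (p ` B) (dim A0)" by (rule two_level_project[OF tl A0 p])
  define M :: nat where "M = 2 ^ (d - 3)"
  have N: "2 ^ d = 8 * M" "2 ^ (d - 2) = 2 * M"
  proof -
    obtain m where "d = m + 3" using assms(2) by (metis add.commute le_Suc_ex)
    then show "2 ^ d = 8 * M" "2 ^ (d - 2) = 2 * M"
      by (simp_all add: M_def power_add numeral_eq_Suc)
  qed
  \<comment> \<open>More than \<open>3/2 * M\<close> points do not fit into dimension
    \<open>d - 3\<close>, and they exceed three quarters of the \<open>2 * M\<close> possible in
    dimension \<open>d - 2\<close>.\<close>
  have A0_gt: "3 * M < 2 * card A0" using dense big N by (simp add: A0_def)
  have le: "dim A0 \<le> d - 2" unfolding A0_def by (rule thin[OF b big])
  have dimA0: "dim A0 = d - 2"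
  proof (rule ccontr)
    assume "dim A0 \<noteq> d - 2"
    then have "dim A0 \<le> d - 3" using le by simp
    then have "(2::nat) ^ dim A0 \<le> M" unfolding M_def by (intro power_increasing) auto
    then show False using two_level_card_le[OF tl0] A0_gt by linarith
  qed
  have A0_le: "card A0 \<le> 2 * M" using two_level_card_le[OF tl0] dimA0 N by simp
  have "\<not> card (p ` B) \<ge> dim A0 + 2"
    using two_level_card_le_three_quarters[OF tl0] dimA0 N A0_gt by auto
  then have pB: "card (p ` B) \<le> d - 1" using dimA0 assms(2) by simp
  \<comment> \<open>Products with \<open>A0\<close> are constant on a fibre, which leaves two
    dimensions free.\<close>
  have fibre: "card {x \<in> B. p x = y} \<le> 4" for y
  proof -
    have "card {x \<in> B. p x = y} \<le> 2 ^ (dim A - dim A0)"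
    proof (rule card_le_pow_dim_diff)
      show "{x \<in> B. p x = y} \<subseteq> span A" using tl' span_superset[of B] by auto
      show "x \<bullet> c = x' \<bullet> c" if "x \<in> {x \<in> B. p x = y}" "x' \<in> {x \<in> B. p x = y}" "c \<in> A0" for x x' c
        using that p(3)[OF span_base, of c] by (metis (mono_tags, lifting) inner_commute mem_Collect_eq)
      show "x \<bullet> a = 0 \<or> x \<bullet> a = 1" if "x \<in> {x \<in> B. p x = y}" "a \<in> A" for x a
        using that bin by (auto simp: inner_commute)
    qed (use fin A0 in auto)
    also have "dim A - dim A0 = 2" using dimA0 tl' assms(2) by simp
    finally show ?thesis by simp
  qed
  text \<open>If \<open>x\<close> vanishes on \<open>A0\<close>, then its zero section contains \<open>A0\<close> and, being thin as well,
    spans nothing more.\<close>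
  have zero_fibre: "{x \<in> B. p x = 0} \<subseteq> {0, b}"
  proof (intro subsetI, rule ccontr)
    fix x assume x: "x \<in> {x \<in> B. p x = 0}" "x \<notin> {0, b}"
    let ?Z = "{a \<in> A. a \<bullet> x = 0}"
    have sub: "A0 \<subseteq> ?Z"
    proof
      fix a assume a: "a \<in> A0"
      then have "a \<bullet> x = a \<bullet> p x" using p(3)[OF span_base] by simp
      then show "a \<in> ?Z" using a A0 x by auto
    qed
    then have "card A0 \<le> card ?Z" using fin by (intro card_mono) auto
    then have "card A \<le> 2 * card ?Z" using big unfolding A0_def by linarith
    then have "dim ?Z \<le> dim A0" using thin[of x] x dimA0 by auto
    then have sp: "span A0 = span ?Z" using sub by (intro dim_eq_span)
    have "x = b"
    proof (rule inner_eq_on_spanning_imp_eq[where S = A])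
      show "x \<in> span A" "b \<in> span A" using x b tl' by (auto simp: span_base)
      show "x \<bullet> a = b \<bullet> a" if a: "a \<in> A" for a
      proof (cases "a \<in> A0")
        case True
        then show ?thesis using sub by (auto simp: A0_def inner_commute)
      next
        case False
        \<comment> \<open>A point of \<open>?Z\<close> lies in the span of \<open>A0\<close>, so it
          is orthogonal to \<open>b\<close> and belongs to \<open>A0\<close>. Hence outside
          \<open>A0\<close> both products are 1.\<close>
        have "a \<notin> ?Z"
        proof
          assume "a \<in> ?Z"
          then have "a \<in> span A0" unfolding sp by (rule span_base)
          then have "orthogonal b a"
            by (rule orthogonal_to_span) (simp add: A0_def orthogonal_def inner_commute)
          then show False using False a by (simp add: A0_def orthogonal_def inner_commute)
        qed
        then show ?thesis
          using False a bin[OF a b(1)] bin[OF a, of x] x by (auto simp: A0_def inner_commute)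
      qed
    qed
    then show False using x by simp
  qed
  have "card {x \<in> B. p x = 0} \<le> 2"
    using card_mono[OF _ zero_fibre] by (simp add: card_insert_if split: if_splits)
  moreover have "card {x \<in> B. p x \<noteq> 0} \<le> 4 * (d - 2)"
  proof -
    have "card {x \<in> B. p x \<noteq> 0} \<le> 4 * card (p ` {x \<in> B. p x \<noteq> 0})"
    proof (rule card_le_fibres)
      show "card {x \<in> {x \<in> B. p x \<noteq> 0}. p x = y} \<le> 4" for y
        by (rule le_trans[OF card_mono fibre[of y]]) (use fin in auto)
    qed (use fin in auto)
    also have "p ` {x \<in> B. p x \<noteq> 0} = p ` B - {0}" by auto
    also have "card \<dots> \<le> d - 2"
      using pB tl0 unfolding two_level_def by (simp add: card_Diff_singleton)
    finally show ?thesis by simp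
  qed
  moreover have "card B = card {x \<in> B. p x = 0} + card {x \<in> B. p x \<noteq> 0}"
  proof -
    have "B = {x \<in> B. p x = 0} \<union> {x \<in> B. p x \<noteq> 0}" by blast
    moreover have "card ({x \<in> B. p x = 0} \<union> {x \<in> B. p x \<noteq> 0})
        = card {x \<in> B. p x = 0} + card {x \<in> B. p x \<noteq> 0}"
      using fin by (intro card_Un_disjoint) auto
    ultimately show ?thesis by simp
  qed
  ultimately have "card B \<le> 4 * (d - 2) + 2" by linarith
  moreover have "card A \<le> 4 * M" using big A0_le unfolding A0_def by linarith
  \<comment> \<open>This is what remains after inserting the bounds on both cardinalities, with
    equality at \<open>d = 4\<close>. Allowing 4 points instead of 2 in the fibre over 0 would be
    too weak already at \<open>d = 3\<close>.\<close>
  moreover have "3 * d \<le> 2 * M + 8"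
    using assms(2) unfolding M_def
  proof (induction d rule: dec_induct)
    case (step m)
    show ?case
    proof (cases "m = 3")
      case False
      then have "Suc m - 3 = Suc (m - 3)" "m - 3 = Suc (m - 4)" using step by auto
      moreover have "(2::nat) ^ (m - 4) \<ge> 1" by simp
      ultimately show ?thesis using step by simp
    qed simp
  qed simp
  ultimately show ?thesis using assms(2) N by simp
qed

lemma two_level_card_add_le:
  fixes A B :: "'a::euclidean_space set"
  assumes "two_level A B d" "card A \<ge> d + 2" "card B \<ge> d + 2"
  shows "4 * (card A + card B) \<le> 3 * 2 ^ d + 4 * d + 8"
  using assms
proof (induction d arbitrary: A B rule: less_induct)
  case (less d)
  show ?case
  proof (cases "d \<le> 2")
    case True
    then have "d = 0 \<or> d = 1 \<or> d = 2" by auto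
    \<comment> \<open>For these \<open>d\<close> the three-quarters bound contradicts
      \<open>card A \<ge> d + 2\<close>.\<close>
    then have "3 * 2 ^ d < 4 * (d + 2)" by auto
    moreover have "4 * card A \<le> 3 * 2 ^ d"
      using two_level_card_le_three_quarters less.prems by blast
    ultimately have "4 * card A < 4 * (d + 2)" by (rule le_less_trans[rotated])
    then show ?thesis using less.prems(2) by simp
  next
    case False
    then have d: "d \<ge> 3" by simp
    have *: "4 * (card A + card B) \<le> 3 * 2 ^ d + 4 * d + 8"
      if tl: "two_level A B d" and cA: "card A \<ge> d + 2" and cB: "card B \<ge> d + 2"
        and le: "card B \<le> card A" for A B :: "'a set"
    proof (rule ccontr)
      assume neg: "\<not> ?thesis"
      \<comment> \<open>The larger family holds at least half of a total exceeding
        \<open>3 * 2 ^ d / 4\<close>.\<close>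
      then have dense: "3 * 2 ^ d < 8 * card A" using le by simp
      have "\<not> B \<subseteq> {0}" using cB card_mono[of "{0}" B] by auto
      then obtain b where "b \<in> B" "b \<noteq> 0" by blast
      then obtain A' B' :: "'a set" and b' where f: "two_level A' B' d" "card A' = card A"
        "card B' = card B" "b' \<in> B'" "b' \<noteq> 0" "card A' \<le> 2 * card {a \<in> A'. a \<bullet> b' = 0}"
        using two_level_flip[OF tl] by blast
      have IH: "4 * (card A + card B) \<le> 3 * 2 ^ (d - 1) + 4 * (d - 1) + 8"
        if "two_level A B (d - 1)" "card A \<ge> d + 1" "card B \<ge> d + 1" for A B :: "'a set"
        by (rule less.IH) (use that d in auto)
      have "dim {a \<in> A'. a \<bullet> x = 0} \<le> d - 2"
        if x: "x \<in> B'" "x \<noteq> 0" "card A' \<le> 2 * card {a \<in> A'. a \<bullet> x = 0}" for x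
      proof -
        have "dim {a \<in> A'. a \<bullet> x = 0} \<noteq> d - 1"
          using two_level_full_section[OF f(1) d _ _ x _ IH] f(2,3) cA cB neg by auto
        \<comment> \<open>Otherwise \<open>x\<close> would be orthogonal to the span of
          \<open>A'\<close>, which contains it.\<close>
        moreover have "dim {a \<in> A'. a \<bullet> x = 0} < d"
        proof (rule ccontr)
          assume "\<not> ?thesis"
          then have "dim A' \<le> dim {a \<in> A'. a \<bullet> x = 0}" using f(1) unfolding two_level_def by simp
          then have "span {a \<in> A'. a \<bullet> x = 0} = span A'" by (intro dim_eq_span) auto
          then have "x \<in> span {a \<in> A'. a \<bullet> x = 0}"
            using f(1) x(1) unfolding two_level_def by (auto simp: span_base)
          then have "x = 0"
            by (rule inner_eq_on_spanning_imp_eq) (auto simp: span_zero inner_commute)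
          then show False using x(2) by simp
        qed
        ultimately show ?thesis by linarith
      qed
      then show False
        using two_level_thin_section[OF f(1) d _ f(4-6)] dense f(2,3) neg by auto
    qed
    show ?thesis
      using *[OF less.prems] *[OF two_level_sym[OF less.prems(1)] less.prems(3,2)]
      by (cases "card B \<le> card A") auto
  qed
qed

section \<open>From bipartite graphs to vector families\<close>

lemma bipartition_sym: "bipartition E X Y \<Longrightarrow> bipartition E Y X"
  unfolding bipartition_def by blast

lemma bipartition_edge:
  assumes "bipartition E X Y" "E u v"
  shows "u \<in> X \<longleftrightarrow> v \<in> Y"
  using assms unfolding bipartition_def independent_set_def by blast

lemma inner_adj_matrix_axis: "adj_matrix E $ x \<bullet> axis y 1 = (if E x y then 1 else 0)"
  by (simp add: adj_matrix_def inner_axis)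

text \<open>Rows of \<open>X\<close> and rows of \<open>Y\<close> have disjoint supports, so their
  dimensions add up; they agree because row rank equals column rank.\<close>

lemma bipartite_graph_rank:
  fixes E :: "'v::finite \<Rightarrow> 'v \<Rightarrow> bool"
  assumes "simple_graph E" "bipartition E X Y"
  shows "graph_rank E = 2 * dim ((\<lambda>x. adj_matrix E $ x) ` X)"
proof -
  let ?r = "\<lambda>x. adj_matrix E $ x"
  have XY: "X \<union> Y = UNIV" "X \<inter> Y = {}" using assms(2) unfolding bipartition_def by auto
  have sym: "E u v \<longleftrightarrow> E v u" for u v
    using assms(1) unfolding simple_graph_def by (meson sympD)
  have "rows (adj_matrix E) = ?r ` UNIV" by (auto simp: rows_def row_def vec_lambda_eta)
  then have "rows (adj_matrix E) = ?r ` X \<union> ?r ` Y" using XY(1) by blast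
  then have "graph_rank E = dim (?r ` X \<union> ?r ` Y)" by (simp add: graph_rank_def row_rank_def)
  also have "\<dots> = dim (?r ` X) + dim (?r ` Y)"
  proof (rule dim_orthogonal_sum)
    fix a b assume "a \<in> ?r ` X" "b \<in> ?r ` Y"
    then obtain x y where xy: "a = ?r x" "b = ?r y" "x \<in> X" "y \<in> Y" by blast
    have *: "a $ i * b $ i = 0" for i
      using bipartition_edge[OF assms(2), of x i] bipartition_edge[OF assms(2), of y i] xy XY
      by (auto simp: adj_matrix_def)
    show "a \<bullet> b = 0" unfolding inner_vec_def inner_real_def by (intro sum.neutral ballI *)
  qed
  also have "dim (?r ` Y) = dim (?r ` X)"
  proof -
    \<comment> \<open>Up to zero rows, \<open>M\<close> has the rows of \<open>X\<close> and its
      transpose those of \<open>Y\<close>.\<close>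
    define M :: "real ^ 'v ^ 'v" where "M = (\<chi> i j. if i \<in> X \<and> E i j then 1 else 0)"
    have "M $ i = (if i \<in> X then ?r i else 0)" for i
      by (simp add: M_def adj_matrix_def vec_eq_iff)
    moreover have "rows M = (\<lambda>i. M $ i) ` UNIV" by (auto simp: rows_def row_def vec_lambda_eta)
    ultimately have "insert 0 (rows M) = insert 0 (?r ` X)" by auto
    then have 1: "rank M = dim (?r ` X)" by (metis row_rank_def dim_span span_insert_0)
    have "transpose M $ i = (if i \<in> Y then ?r i else 0)" for i
      using bipartition_edge[OF assms(2), of _ i] sym
      by (auto simp: M_def adj_matrix_def vec_eq_iff transpose_def)
    moreover have "rows (transpose M) = (\<lambda>i. transpose M $ i) ` UNIV"
      by (auto simp: rows_def row_def vec_lambda_eta)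
    ultimately have "insert 0 (rows (transpose M)) = insert 0 (?r ` Y)" by auto
    then have "rank (transpose M) = dim (?r ` Y)" by (metis row_rank_def dim_span span_insert_0)
    then show ?thesis using 1 by (simp add: rank_transpose)
  qed
  finally show ?thesis by simp
qed

text \<open>The biadjacency matrix is factored as the Gram matrix between its rows and the projections
  of the unit vectors onto its row space.\<close>

lemma bipartite_two_level:
  fixes E :: "'v::finite \<Rightarrow> 'v \<Rightarrow> bool"
  assumes "simple_graph E" "reduced_graph E" "bipartition E X Y"
  obtains A B :: "(real ^ 'v) set"
  where "two_level A B (graph_rank E div 2)" "card A = card X + 1" "card B = card Y + 1"
proof -
  let ?r = "\<lambda>x. adj_matrix E $ x"
  have XY: "X \<union> Y = UNIV" "X \<inter> Y = {}" using assms(3) unfolding bipartition_def by auto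
  have sym: "E u v \<longleftrightarrow> E v u" for u v
    using assms(1) unfolding simple_graph_def by (meson sympD)
  have dist: "u = v" if "\<And>w. E u w \<longleftrightarrow> E v w" for u v
    using assms(2) that unfolding reduced_graph_def neighbors_def by (metis (no_types, lifting) Collect_cong)
  have nbr: "\<exists>w. E u w" for u
    using assms(2) unfolding reduced_graph_def neighbors_def by blast
  obtain p where p: "linear p" "\<And>x. p x \<in> span (?r ` X)"
    "\<And>x w. w \<in> span (?r ` X) \<Longrightarrow> w \<bullet> p x = w \<bullet> x" "\<And>w. w \<in> span (?r ` X) \<Longrightarrow> p w = w"
    using orthogonal_projection_exists[of "?r ` X"] by blast
  let ?b = "\<lambda>y. p (axis y 1)"
  have prod: "?r x \<bullet> ?b y = (if E x y then 1 else 0)" if "x \<in> X" for x y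
    using p(3)[of "?r x" "axis y 1"] that inner_adj_matrix_axis[of E x y] by (simp add: span_base)
  \<comment> \<open>Reducedness enters here: distinct neighbourhoods give distinct vectors and the
    absence of isolated vertices gives nonzero ones, so adding 0 raises each count by exactly
    one.\<close>
  have "inj_on ?r X"
  proof (rule inj_onI)
    fix x x' assume "?r x = ?r x'"
    then have "adj_matrix E $ x $ w = adj_matrix E $ x' $ w" for w by simp
    then show "x = x'" by (intro dist) (simp add: adj_matrix_def split: if_splits, metis zero_neq_one)
  qed
  moreover have "0 \<notin> ?r ` X"
  proof
    assume "0 \<in> ?r ` X"
    then obtain x where "?r x = 0" by auto
    then have *: "adj_matrix E $ x $ w = 0" for w by simp
    obtain w where "E x w" using nbr by blast
    then show False using *[of w] by (simp add: adj_matrix_def)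
  qed
  ultimately have cA: "card (insert 0 (?r ` X)) = card X + 1" by (simp add: card_image)
  have "inj_on ?b Y"
  proof (rule inj_onI)
    fix y y' assume y: "y \<in> Y" "y' \<in> Y" and eq: "?b y = ?b y'"
    show "y = y'"
    proof (rule dist)
      fix w
      show "E y w \<longleftrightarrow> E y' w"
      proof (cases "w \<in> X")
        case True
        then show ?thesis using prod[OF True, of y] prod[OF True, of y'] eq sym
          by (auto split: if_splits)
      next
        case False
        then show ?thesis using bipartition_edge[OF bipartition_sym[OF assms(3)]] y by blast
      qed
    qed
  qed
  moreover have "0 \<notin> ?b ` Y"
  proof
    assume "0 \<in> ?b ` Y"
    then obtain y where y: "y \<in> Y" "?b y = 0" by auto
    obtain w where w: "E y w" using nbr by blast
    then have "w \<in> X" using bipartition_edge[OF bipartition_sym[OF assms(3)] w] y by blast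
    then show False using prod[of w y] y w sym by auto
  qed
  ultimately have cB: "card (insert 0 (?b ` Y)) = card Y + 1" by (simp add: card_image)
  have "span (?b ` Y) = span (?r ` X)"
  proof (rule span_eq[THEN iffD2], intro conjI)
    show "?b ` Y \<subseteq> span (?r ` X)" using p(2) by blast
    \<comment> \<open>A row of \<open>X\<close> is supported on \<open>Y\<close>, so it combines
      unit vectors of \<open>Y\<close> and is fixed by \<open>p\<close>.\<close>
    have "?r x \<in> p ` span ((\<lambda>y. axis y 1) ` Y)" if x: "x \<in> X" for x
    proof -
      have "?r x = (\<Sum>y\<in>UNIV. (?r x $ y) *\<^sub>R axis y 1)"
        using basis_expansion[of "?r x"] by (simp add: scalar_mult_eq_scaleR)
      also have "\<dots> = (\<Sum>y\<in>Y. (?r x $ y) *\<^sub>R axis y 1)"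
        by (rule sum.mono_neutral_right)
          (use bipartition_edge[OF assms(3), of x] x in \<open>auto simp: adj_matrix_def\<close>)
      also have "\<dots> \<in> span ((\<lambda>y. axis y 1) ` Y)"
        by (intro span_sum span_scale span_base) blast
      finally have "?r x \<in> span ((\<lambda>y. axis y 1) ` Y)" .
      moreover have "p (?r x) = ?r x" using p(4) x by (simp add: span_base)
      ultimately show ?thesis by (metis image_eqI)
    qed
    moreover have "span (?b ` Y) = p ` span ((\<lambda>y. axis y 1) ` Y)"
      using linear_span_image[OF p(1), of "(\<lambda>y. axis y 1) ` Y"] by (simp add: image_image)
    ultimately show "?r ` X \<subseteq> span (?b ` Y)" by blast
  qed
  moreover have "dim (?r ` X) = graph_rank E div 2"
    using bipartite_graph_rank[OF assms(1,3)] by simp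
  ultimately have "two_level (insert 0 (?r ` X)) (insert 0 (?b ` Y)) (graph_rank E div 2)"
    using prod unfolding two_level_def by (auto simp: dim_insert span_zero)
  then show ?thesis using that cA cB by blast
qed

theorem theorem3p1:
  fixes E :: "'v::finite \<Rightarrow> 'v \<Rightarrow> bool"
    and X Y :: "'v set"
    and r n :: nat
  assumes "simple_graph E"
    and "reduced_graph E"
    and "bipartition E X Y"
    and "r = graph_rank E"
    and "r \<ge> 6"
    and "n = CARD('v)"
    and "real n > c_bound r"
  shows "real (min (card X) (card Y)) = real r / 2"
proof -
  define k where "k = r div 2"
  have r: "r = 2 * k"
    using bipartite_graph_rank[OF assms(1,3)] assms(4) by (simp add: k_def)
  obtain A B :: "(real ^ 'v) set"
    where AB: "two_level A B k" "card A = card X + 1" "card B = card Y + 1"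
    using bipartite_two_level[OF assms(1-3)] assms(4) unfolding k_def by blast
  have ge: "card X \<ge> k" "card Y \<ge> k"
    using two_level_card_ge[OF AB(1)] two_level_card_ge[OF two_level_sym[OF AB(1)]] AB by auto
  have "card (X \<union> Y) = card X + card Y"
    using assms(3) unfolding bipartition_def by (intro card_Un_disjoint) auto
  then have n: "n = card X + card Y"
    using assms(3,6) unfolding bipartition_def by simp
  have "min (card X) (card Y) = k"
  proof (rule ccontr)
    assume "min (card X) (card Y) \<noteq> k"
    \<comment> \<open>Both sides now have at least \<open>k + 1\<close> vertices, and the zero
      vector adds one more. Removing the two zero vectors from the resulting bound turns
      \<open>4 * k + 8\<close> into \<open>4 * k\<close>.\<close>
    then have "card A \<ge> k + 2" "card B \<ge> k + 2" using ge AB by auto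
    then have "4 * (card A + card B) \<le> 3 * 2 ^ k + 4 * k + 8"
      by (rule two_level_card_add_le[OF AB(1)])
    then have "4 * n \<le> 3 * 2 ^ k + 4 * k" using AB n by simp
    then have "real (4 * n) \<le> real (3 * 2 ^ k + 4 * k)" by (rule of_nat_mono)
    moreover have "c_bound r = 3 * (2 ^ k / 4) + real k"
      by (simp add: c_bound_def r powr_diff powr_realpow)
    ultimately show False using assms(7) by simp
  qed
  then show ?thesis using r by simp
qed

end
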